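(* The graph $G(3)$ is the unique (up to isomorphism) non-complete abundant cubic graph.
   Context: All graphs are simple, connected and finite; a cubic graph is a $3$-regular graph. A set $S$ of vertices of a graph $H$ is a general position set if no shortest path in $H$ contains three or more vertices of $S$; $\mathrm{gp}(H)$ is the number of vertices in a largest general position set of $H$. The Mycielskian $\mathcal{M}(G)$ of a graph $G$ with vertex set $V$ and edge set $E$ has vertex set $V\cup V'\cup\{u^*\}$, where $V'=\{u' : u\in V\}$ is a disjoint copy of $V$ and $u^*$ is an additional vertex (the root), and edge set $E\cup\{uv' : uv\in E\}\cup\{v'u^* : v'\in V'\}$ (for each edge $uv\in E$ both $uv'$ and $vu'$ are included). An independent $4$-position set of $G$ is a subset $S\subseteq V(G)$ that is an independent set and such that no shortest path of $G$ of length at most $4$ passes through three or more vertices of $S$; $\mathrm{ip}_4(G)$ is the largest number of vertices in such a set. A non-complete graph $G$ with order $n\geq 3$ is meagre if $\mathrm{gp}(\mathcal{M}(G))=\max\{n,2\,\mathrm{ip}_4(G)\}$ and abundant otherwise, i.e. if $\mathrm{gp}(\mathcal{M}(G))>\max\{n,2\,\mathrm{ip}_4(G)\}$. The graph $G(d)$, for $d\geq 2$, is formed from disjoint vertex sets $V_1,V_2,V_4$ with $|V_1|=|V_2|=d$ and $|V_4|=d-1$ by making $(V_1,V_4)$ a complete bipartite graph $K_{d,d-1}$, making $V_2$ a clique $K_d$, joining $V_1$ and $V_2$ by a matching of size $d$, and adding no other edges; so $G(3)$ has order $8$. *)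

theory Defs
  imports "Graph_Theory.Graph_Theory"
begin

text \<open>
  A finite simple graph is a \<^locale>\<open>pair_graph\<close>: a finite vertex set with a symmetric,
  irreflexive arc relation, each undirected edge being represented by its two orientations.
\<close>

definition connected_graph :: "'a pair_pre_digraph \<Rightarrow> bool" where
  "connected_graph G \<longleftrightarrow> pair_graph G \<and> connected (with_proj G)"

definition cubic :: "'a pair_pre_digraph \<Rightarrow> bool" where
  "cubic G \<longleftrightarrow> connected_graph G \<and> (\<forall>v \<in> pverts G. out_degree (with_proj G) v = 3)"

definition complete_graph :: "'a pair_pre_digraph \<Rightarrow> bool" where
  "complete_graph G \<longleftrightarrow> complete_digraph (card (pverts G)) (with_proj G)"

text \<open>Paths are vertex lists; \<^const>\<open>vwalk_length\<close> counts edges.\<close>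

definition shortest_path :: "'a pair_pre_digraph \<Rightarrow> 'a vwalk \<Rightarrow> bool" where
  "shortest_path G p \<longleftrightarrow> vpath p (with_proj G) \<and>
     (\<forall>q. vpath q (with_proj G) \<and> hd q = hd p \<and> last q = last p
        \<longrightarrow> vwalk_length p \<le> vwalk_length q)"

definition general_position_set :: "'a pair_pre_digraph \<Rightarrow> 'a set \<Rightarrow> bool" where
  "general_position_set G S \<longleftrightarrow> S \<subseteq> pverts G \<and>
     (\<forall>p. shortest_path G p \<longrightarrow> card (set p \<inter> S) < 3)"

definition gp :: "'a pair_pre_digraph \<Rightarrow> nat" where
  "gp G = Max (card ` {S. general_position_set G S})"

definition independent_set :: "'a pair_pre_digraph \<Rightarrow> 'a set \<Rightarrow> bool" where
  "independent_set G S \<longleftrightarrow> S \<subseteq> pverts G \<and> (\<forall>u \<in> S. \<forall>v \<in> S. (u, v) \<notin> parcs G)"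

definition independent_4_position_set :: "'a pair_pre_digraph \<Rightarrow> 'a set \<Rightarrow> bool" where
  "independent_4_position_set G S \<longleftrightarrow> independent_set G S \<and>
     (\<forall>p. shortest_path G p \<and> vwalk_length p \<le> 4 \<longrightarrow> card (set p \<inter> S) < 3)"

definition ip\<^sub>4 :: "'a pair_pre_digraph \<Rightarrow> nat" where
  "ip\<^sub>4 G = Max (card ` {S. independent_4_position_set G S})"

datatype 'a mycielski_vertex = Orig 'a | Copy 'a | Root

definition mycielskian :: "'a pair_pre_digraph \<Rightarrow> 'a mycielski_vertex pair_pre_digraph" where
  "mycielskian G = \<lparr>
     pverts = Orig ` pverts G \<union> Copy ` pverts G \<union> {Root},
     parcs = {(Orig u, Orig v) | u v. (u, v) \<in> parcs G}
       \<union> {(Orig u, Copy v) | u v. (u, v) \<in> parcs G}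
       \<union> {(Copy u, Orig v) | u v. (u, v) \<in> parcs G}
       \<union> {(Copy v, Root) | v. v \<in> pverts G}
       \<union> {(Root, Copy v) | v. v \<in> pverts G} \<rparr>"

definition abundant :: "'a pair_pre_digraph \<Rightarrow> bool" where
  "abundant G \<longleftrightarrow> \<not> complete_graph G \<and> card (pverts G) \<ge> 3 \<and>
     gp (mycielskian G) > max (card (pverts G)) (2 * ip\<^sub>4 G)"

datatype Gd_vertex = V1 nat | V2 nat | V4 nat

text \<open>The graph $G(d)$, meant for \<open>d \<ge> 2\<close>; the matching joins \<open>V1 i\<close> to \<open>V2 i\<close>.\<close>

definition Gd_edges :: "nat \<Rightarrow> Gd_vertex rel" where
  "Gd_edges d =
     {(V1 i, V4 j) | i j. i < d \<and> j < d - 1}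
     \<union> {(V2 i, V2 j) | i j. i < d \<and> j < d \<and> i \<noteq> j}
     \<union> {(V1 i, V2 i) | i. i < d}"

definition Gd :: "nat \<Rightarrow> Gd_vertex pair_pre_digraph" where
  "Gd d = \<lparr>
     pverts = V1 ` {..<d} \<union> V2 ` {..<d} \<union> V4 ` {..<d - 1},
     parcs = Gd_edges d \<union> (Gd_edges d)\<inverse> \<rparr>"

end

theory Submission
  imports Defs
begin

text \<open>
  Consider a general position set \<open>K\<close> of the Mycielskian of a cubic graph \<open>G\<close> on \<open>n\<close> vertices
  with more than \<open>n\<close> elements; write \<open>v'\<close> for the copy of \<open>v\<close> and \<open>u\<^sup>*\<close> for the root.
  The root cannot belong to \<open>K\<close> unless \<open>G\<close> is complete
  (\<open>Root_notin_large_general_position_set\<close>). Let \<open>A\<close> be the set of vertices that \<open>K\<close> contains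
  together with their copies and \<open>D\<close> the set of vertices of which \<open>K\<close> contains neither; then
  \<open>card D < card A\<close>.

  A neighbour \<open>w\<close> of \<open>a \<in> A\<close> is not in \<open>K\<close>, since \<open>a, w, a'\<close> is a shortest path. So it lies in
  \<open>D\<close>, or only its copy is in \<open>K\<close>. Arcs of the second kind form a matching \<open>P\<close>: two of them with
  a common end give a shortest path of length 2 through three elements of \<open>K\<close>. Comparing the
  \<open>3 * card A\<close> arcs out of \<open>A\<close> with the \<open>3 * card D\<close> arcs out of \<open>D\<close> gives
  \<open>card P = 3 * (card A - card D) + card H \<ge> 3 + card H\<close>, where \<open>H\<close> is the set of arcs from \<open>D\<close>
  that miss \<open>A\<close>.

  For an arc \<open>(a, c)\<close> of \<open>P\<close> and another selected copy \<open>t'\<close>, the walk \<open>a, c', u\<^sup>*, t'\<close> through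
  the root has length 3, so \<open>t\<close> must be within distance 2 of \<open>a\<close> (\<open>common_nbr_with_copy\<close>). It
  follows that an end \<open>c\<close> of \<open>P\<close> without neighbours in \<open>D\<close> is adjacent to all other ends of \<open>P\<close>.
  There are at least three such \<open>c\<close>, and each has only two neighbours besides its partner; hence
  \<open>card P = 3\<close>, \<open>H\<close> is empty, the ends of \<open>P\<close> form a triangle and \<open>card A = card D + 1\<close>. One
  more shortest path of length 3 shows that every vertex of \<open>A\<close> is matched, so \<open>card A = 3\<close> and
  \<open>card D = 2\<close>, and the vertices of \<open>D\<close> are adjacent to exactly those of \<open>A\<close>
  (\<open>large_general_position_set_structure\<close>). These eight vertices are closed under adjacency, and
  the graph on them is \<open>G(3)\<close> with \<open>V\<^sub>1 = A\<close>, \<open>V\<^sub>4 = D\<close> and \<open>V\<^sub>2\<close> the triangle (\<open>iso_Gd_3I\<close>).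

  Conversely, reversing this analysis gives a general position set with nine elements in the
  Mycielskian of \<open>G(3)\<close> (\<open>abundant_Gd_3\<close>), while \<open>G(3)\<close> has eight vertices and no independent set
  of more than four vertices.
\<close>

section \<open>Short shortest paths and general position\<close>

text \<open>
  The definition of a shortest path compares it with paths only; walks suffice because removing
  the cycles from a walk does not lengthen it. This spares a proof of distinctness whenever a
  shortcut is spliced into a path.
\<close>

lemma shortest_path_le_vwalk:
  assumes "shortest_path G p" "vwalk q (with_proj G)" "hd q = hd p" "last q = last p"
  shows "length p \<le> length q"
proof -
  let ?q = "vwalk_to_vpath q"
  have "q \<noteq> []" "p \<noteq> []"
    using assms by (auto simp: vwalk_def shortest_path_def vpath_def)
  have "vpath ?q (with_proj G)"
    using assms(2) by (rule vwalk_to_vpath_vpath)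
  moreover have "hd ?q = hd p" "last ?q = last p"
    using assms(2-4) \<open>q \<noteq> []\<close> by (simp_all add: vwalk_to_vpath_hd vwalk_to_vpath_last)
  ultimately have "length p - 1 \<le> length ?q - 1"
    using assms(1) by (auto simp: shortest_path_def)
  moreover have "length ?q \<le> length q"
    by (induct q rule: vwalk_to_vpath.induct)
      (auto intro: le_SucI order_trans[OF _ length_dropWhile_le])
  moreover have "?q \<noteq> []"
    using \<open>q \<noteq> []\<close> by (rule vwalk_to_vpath_nonempty)
  ultimately show ?thesis
    using \<open>p \<noteq> []\<close> by (cases p; cases ?q) auto
qed

lemma (in pair_loopfree_digraph) shortest_path_of_length_2:
  assumes "(x, y) \<in> parcs G" "(y, z) \<in> parcs G" "x \<noteq> z" "(x, z) \<notin> parcs G"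
  shows "shortest_path G [x, y, z]"
  unfolding shortest_path_def
proof (intro conjI allI impI)
  show "vpath [x, y, z] (with_proj G)"
    using assms no_loops' in_arcsD1 in_arcsD2 by (auto simp: vpath_def vwalk_def)
next
  fix q
  assume q: "vpath q (with_proj G) \<and> hd q = hd [x, y, z] \<and> last q = last [x, y, z]"
  then show "vwalk_length [x, y, z] \<le> vwalk_length q"
    using assms by (auto simp: vpath_def vwalk_def neq_Nil_conv split: if_splits)
qed

lemma (in pair_loopfree_digraph) shortest_path_of_length_3:
  assumes "(x, y) \<in> parcs G" "(y, z) \<in> parcs G" "(z, w) \<in> parcs G" "x \<noteq> w" "(x, w) \<notin> parcs G"
    and no_common: "\<And>v. (x, v) \<in> parcs G \<Longrightarrow> (v, w) \<notin> parcs G"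
  shows "shortest_path G [x, y, z, w]"
  unfolding shortest_path_def
proof (intro conjI allI impI)
  show "vpath [x, y, z, w] (with_proj G)"
    using assms no_loops' in_arcsD1 in_arcsD2 by (auto simp: vpath_def vwalk_def)
next
  fix q
  assume q: "vpath q (with_proj G) \<and> hd q = hd [x, y, z, w] \<and> last q = last [x, y, z, w]"
  then show "vwalk_length [x, y, z, w] \<le> vwalk_length q"
    using assms by (auto simp: vpath_def vwalk_def neq_Nil_conv split: if_splits)
qed

lemma general_position_set_not_on_shortest_path:
  assumes "general_position_set G S" "shortest_path G p"
    and "{x, y, z} \<subseteq> set p" "x \<noteq> y" "y \<noteq> z" "x \<noteq> z"
  shows "\<not> {x, y, z} \<subseteq> S"
proof
  assume "{x, y, z} \<subseteq> S"
  then have "card {x, y, z} \<le> card (set p \<inter> S)"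
    using assms(3) by (intro card_mono) auto
  with assms show False
    by (auto simp: general_position_set_def)
qed

text \<open>
  Two vertices of such a set \<open>K\<close> are never more than two steps apart on a shortest path, so
  three of them on a shortest path would be three consecutive vertices, and the middle one
  would have two neighbours in \<open>K\<close>.
\<close>

lemma general_position_setI_diameter_2:
  assumes K: "K \<subseteq> pverts G"
    and near: "\<And>x y. x \<in> K \<Longrightarrow> y \<in> K \<Longrightarrow> x \<noteq> y \<Longrightarrow>
      (x, y) \<in> parcs G \<or> (\<exists>w \<in> pverts G. (x, w) \<in> parcs G \<and> (w, y) \<in> parcs G)"
    and matching: "\<And>x y z. x \<in> K \<Longrightarrow> y \<in> K \<Longrightarrow> z \<in> K \<Longrightarrow>
      (x, y) \<in> parcs G \<Longrightarrow> (y, z) \<in> parcs G \<Longrightarrow> x = z"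
  shows "general_position_set G K"
  unfolding general_position_set_def
proof (intro conjI allI impI)
  show "K \<subseteq> pverts G" by (rule K)
next
  fix p
  assume p: "shortest_path G p"
  then have path: "vwalk p (with_proj G)" "distinct p"
    by (auto simp: shortest_path_def vpath_def)
  show "card (set p \<inter> K) < 3"
  proof (rule ccontr)
    assume "\<not> card (set p \<inter> K) < 3"
    moreover have "card (set p \<inter> K) = length (filter (\<lambda>v. v \<in> K) p)"
      using path(2) distinct_card[of "filter (\<lambda>v. v \<in> K) p"]
      by (simp add: Int_def conj_commute)
    ultimately obtain x y z r where f: "filter (\<lambda>v. v \<in> K) p = x # y # z # r"
      by (cases "filter (\<lambda>v. v \<in> K) p" rule: remdups_adj.cases)
        (auto simp: not_less numeral_3_eq_3 Suc_le_eq neq_Nil_conv)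
    obtain s p' where 1: "p = s @ x # p'" "x \<in> K" "y # z # r = filter (\<lambda>v. v \<in> K) p'"
      using filter_eq_ConsD[OF f] by blast
    obtain t p'' where 2: "p' = t @ y # p''" "y \<in> K" "z # r = filter (\<lambda>v. v \<in> K) p''"
      using filter_eq_ConsD[OF 1(3)[symmetric]] by blast
    obtain u e where 3: "p'' = u @ z # e" "z \<in> K"
      using filter_eq_ConsD[OF 2(3)[symmetric]] by blast
    have p_eq: "p = s @ (x # t @ y # u) @ (z # e)"
      using 1 2 3 by simp
    have "x \<noteq> z"
      using path(2) p_eq by auto
    obtain m where m: "length m \<le> 1" "set m \<subseteq> pverts G"
        "set (vwalk_arcs (x # m @ [z])) \<subseteq> parcs G"
    proof (cases "(x, z) \<in> parcs G")
      case True
      then show ?thesis using that[of "[]"] by auto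
    next
      case False
      then obtain w where "w \<in> pverts G" "(x, w) \<in> parcs G" "(w, z) \<in> parcs G"
        using near 1(2) 3(2) \<open>x \<noteq> z\<close> by blast
      then show ?thesis using that[of "[w]"] by auto
    qed
    let ?q = "s @ (x # m) @ (z # e)"
    have "vwalk (s @ [x]) (with_proj G)"
      using vwalkI_append_l[of "s @ [x]" "t @ y # u @ z # e"] path(1) p_eq by simp
    moreover have "vwalk (z # e) (with_proj G)"
      using vwalkI_append_r[of "z # e" "s @ x # t @ y # u"] path(1) p_eq by simp
    ultimately have "vwalk ?q (with_proj G)"
      using m
      by (cases "s = []"; cases "m = []")
        (auto simp: vwalk_def vwalk_arcs_append hd_append)
    moreover have "hd ?q = hd p" "last ?q = last p"
      unfolding p_eq by (simp_all add: hd_append)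
    ultimately have "length p \<le> length ?q"
      using shortest_path_le_vwalk p by blast
    then have "Suc (length t + length u) \<le> length m"
      using p_eq by simp
    with m(1) have "length t + length u = 0"
      by linarith
    then have "t = []" "u = []"
      by simp_all
    then have "vwalk ([x, y, z] @ e) (with_proj G)"
      using path(1) p_eq vwalkI_append_r[of "[x, y, z] @ e" s] by simp
    then have "(x, y) \<in> parcs G" "(y, z) \<in> parcs G"
      by (simp_all add: vwalk_def)
    then show False
      using matching 1(2) 2(2) 3(2) \<open>x \<noteq> z\<close> by blast
  qed
qed

lemma finite_cards_of_subsets:
  assumes "finite V" "\<And>S. P S \<Longrightarrow> S \<subseteq> V"
  shows "finite (card ` {S. P S})"
  using assms by (auto intro!: finite_imageI intro: finite_subset[of _ "Pow V"])

lemma card_le_gp: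
  assumes "finite (pverts G)" "general_position_set G S"
  shows "card S \<le> gp G"
  unfolding gp_def using assms
  by (intro Max_ge finite_cards_of_subsets) (auto simp: general_position_set_def)

lemma gp_greaterE:
  assumes "finite (pverts G)" "n < gp G"
  obtains S where "general_position_set G S" "n < card S"
proof -
  have "general_position_set G {}"
    by (simp add: general_position_set_def)
  then have "gp G \<in> card ` {S. general_position_set G S}"
    unfolding gp_def using assms(1)
    by (intro Max_in finite_cards_of_subsets) (auto simp: general_position_set_def)
  with assms(2) that show ?thesis by auto
qed

lemma ip\<^sub>4_le:
  assumes "finite (pverts G)" "\<And>S. independent_set G S \<Longrightarrow> card S \<le> n"
  shows "ip\<^sub>4 G \<le> n"
proof -
  have "independent_4_position_set G {}"
    by (simp add: independent_4_position_set_def independent_set_def)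
  then have "ip\<^sub>4 G \<in> card ` {S. independent_4_position_set G S}"
    unfolding ip\<^sub>4_def using assms(1)
    by (intro Max_in finite_cards_of_subsets)
      (auto simp: independent_4_position_set_def independent_set_def)
  with assms(2) show ?thesis
    by (auto simp: independent_4_position_set_def)
qed

section \<open>The Mycielskian\<close>

lemma mycielskian_arcs [simp]:
  "(Orig u, Orig v) \<in> parcs (mycielskian G) \<longleftrightarrow> (u, v) \<in> parcs G"
  "(Orig u, Copy v) \<in> parcs (mycielskian G) \<longleftrightarrow> (u, v) \<in> parcs G"
  "(Copy u, Orig v) \<in> parcs (mycielskian G) \<longleftrightarrow> (u, v) \<in> parcs G"
  "(Copy u, Copy v) \<notin> parcs (mycielskian G)"
  "(Orig u, Root) \<notin> parcs (mycielskian G)"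
  "(Root, Orig u) \<notin> parcs (mycielskian G)"
  "(Root, Root) \<notin> parcs (mycielskian G)"
  "(Copy u, Root) \<in> parcs (mycielskian G) \<longleftrightarrow> u \<in> pverts G"
  "(Root, Copy u) \<in> parcs (mycielskian G) \<longleftrightarrow> u \<in> pverts G"
  by (auto simp: mycielskian_def)

lemma mycielskian_verts [simp]:
  "Orig u \<in> pverts (mycielskian G) \<longleftrightarrow> u \<in> pverts G"
  "Copy u \<in> pverts (mycielskian G) \<longleftrightarrow> u \<in> pverts G"
  "Root \<in> pverts (mycielskian G)"
  by (auto simp: mycielskian_def)

lemma finite_pverts_mycielskian:
  "finite (pverts G) \<Longrightarrow> finite (pverts (mycielskian G))"
  by (simp add: mycielskian_def)

lemma (in pair_loopfree_digraph) pair_loopfree_digraph_mycielskian: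
  "pair_loopfree_digraph (mycielskian G)"
proof
  fix e assume "e \<in> parcs (mycielskian G)"
  moreover obtain x y where "e = (x, y)" by (cases e)
  ultimately show "fst e \<in> pverts (mycielskian G)" "snd e \<in> pverts (mycielskian G)"
      "fst e \<noteq> snd e"
    using in_arcsD1 in_arcsD2 no_loops' by (cases x; cases y; force)+
qed

section \<open>Cubic graphs\<close>

abbreviation nbrs :: "'a pair_pre_digraph \<Rightarrow> 'a \<Rightarrow> 'a set" where
  "nbrs G v \<equiv> {w. (v, w) \<in> parcs G}"

lemma out_degree_eq_card_nbrs: "out_degree (with_proj G) v = card (nbrs G v)"
proof -
  have "out_arcs (with_proj G) v = Pair v ` nbrs G v"
    by auto
  then show ?thesis
    by (simp add: out_degree_def card_image inj_on_def)
qed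

lemma cubicD:
  assumes "cubic G"
  shows "pair_graph G" "connected_graph G" "\<And>v. v \<in> pverts G \<Longrightarrow> card (nbrs G v) = 3"
  using assms by (auto simp: cubic_def connected_graph_def out_degree_eq_card_nbrs)

lemma connected_graph_closed_set:
  assumes "connected_graph G" "X \<subseteq> pverts G" "X \<noteq> {}"
    and closed: "\<And>x. x \<in> X \<Longrightarrow> nbrs G x \<subseteq> X"
  shows "X = pverts G"
proof
  interpret pair_graph G
    using assms(1) by (simp add: connected_graph_def)
  show "pverts G \<subseteq> X"
  proof
    fix v assume "v \<in> pverts G"
    obtain x where "x \<in> X" using assms(3) by blast
    have "(parcs G)\<^sup>s = parcs G"
      using arcs_symmetric by (auto simp: symcl_def)
    then have "(x, v) \<in> rtrancl_on (pverts G) (parcs G)"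
      using assms(1,2) \<open>x \<in> X\<close> \<open>v \<in> pverts G\<close>
      by (auto simp: connected_graph_def connected_conv)
    then show "v \<in> X"
    proof (induct rule: rtrancl_on_induct)
      case base
      show ?case by (rule \<open>x \<in> X\<close>)
    next
      case (step y z)
      then show ?case using closed by blast
    qed
  qed
qed (rule assms(2))

text \<open>
  If adjacency is transitive up to equality, a vertex together with its neighbours is closed
  under taking neighbours, hence is the whole graph by connectedness.
\<close>

lemma complete_graph_if_no_induced_path:
  assumes "connected_graph G"
    and trans: "\<And>x y z. (x, y) \<in> parcs G \<Longrightarrow> (y, z) \<in> parcs G \<Longrightarrow> x \<noteq> z \<Longrightarrow> (x, z) \<in> parcs G"
  shows "complete_graph G"
proof -
  interpret pair_graph G
    using assms(1) by (simp add: connected_graph_def)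
  have all: "insert u (nbrs G u) = pverts G" if "u \<in> pverts G" for u
  proof (rule connected_graph_closed_set[OF assms(1)])
    show "insert u (nbrs G u) \<subseteq> pverts G"
      using that in_arcsD2 by auto
    show "nbrs G x \<subseteq> insert u (nbrs G u)" if "x \<in> insert u (nbrs G u)" for x
      using that trans by blast
  qed simp
  have "parcs G = {(u, v). (u, v) \<in> pverts G \<times> pverts G \<and> u \<noteq> v}"
    using all in_arcsD1 in_arcsD2 no_loops' by blast
  then show ?thesis
    using pair_finite_verts by (simp add: complete_graph_def complete_digraph_pair_def)
qed

section \<open>The graph G(3) is cubic and abundant\<close>

lemma less_3_iff: "i < (3::nat) \<longleftrightarrow> i = 0 \<or> i = 1 \<or> i = 2"
  by auto

lemma less_2_iff: "i < (2::nat) \<longleftrightarrow> i = 0 \<or> i = 1"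
  by auto

lemma Gd_3_verts [simp]:
  "V1 i \<in> pverts (Gd 3) \<longleftrightarrow> i < 3"
  "V2 i \<in> pverts (Gd 3) \<longleftrightarrow> i < 3"
  "V4 i \<in> pverts (Gd 3) \<longleftrightarrow> i < 2"
  by (auto simp: Gd_def)

lemma Gd_3_arcs [simp]:
  "(V1 i, V1 j) \<notin> parcs (Gd 3)"
  "(V4 i, V4 j) \<notin> parcs (Gd 3)"
  "(V2 i, V4 j) \<notin> parcs (Gd 3)"
  "(V4 i, V2 j) \<notin> parcs (Gd 3)"
  "(V2 i, V2 j) \<in> parcs (Gd 3) \<longleftrightarrow> i < 3 \<and> j < 3 \<and> i \<noteq> j"
  "(V1 i, V2 j) \<in> parcs (Gd 3) \<longleftrightarrow> i < 3 \<and> i = j"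
  "(V2 i, V1 j) \<in> parcs (Gd 3) \<longleftrightarrow> i < 3 \<and> i = j"
  "(V1 i, V4 j) \<in> parcs (Gd 3) \<longleftrightarrow> i < 3 \<and> j < 2"
  "(V4 j, V1 i) \<in> parcs (Gd 3) \<longleftrightarrow> i < 3 \<and> j < 2"
  by (auto simp: Gd_def Gd_edges_def)

lemma finite_Gd_3: "finite (pverts (Gd 3))"
  by (simp add: Gd_def)

lemma card_Gd_3: "card (pverts (Gd 3)) = 8"
proof -
  have "pverts (Gd 3) = {V1 0, V1 1, V1 2, V2 0, V2 1, V2 2, V4 0, V4 1}"
    by (auto simp: Gd_def less_3_iff less_2_iff)
  then show ?thesis by simp
qed

lemma pair_graph_Gd_3: "pair_graph (Gd 3)"
proof
  show "finite (pverts (Gd 3))" by (rule finite_Gd_3)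
  have arc: "x \<in> pverts (Gd 3) \<and> y \<in> pverts (Gd 3) \<and> x \<noteq> y \<and> (y, x) \<in> parcs (Gd 3)"
    if "(x, y) \<in> parcs (Gd 3)" for x y
    using that by (cases x; cases y) auto
  show "fst e \<in> pverts (Gd 3)" "snd e \<in> pverts (Gd 3)" "fst e \<noteq> snd e"
    if "e \<in> parcs (Gd 3)" for e
    using arc[of "fst e" "snd e"] that by simp_all
  have "parcs (Gd 3) \<subseteq> pverts (Gd 3) \<times> pverts (Gd 3)"
    using arc by auto
  then show "finite (parcs (Gd 3))"
    using finite_Gd_3 by (auto intro: finite_subset)
  show "symmetric (with_proj (Gd 3))"
    using arc by (auto simp: symmetric_def sym_def)
qed

lemma nbrs_Gd_3:
  "i < 3 \<Longrightarrow> nbrs (Gd 3) (V1 i) = {V2 i, V4 0, V4 1}"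
  "i < 3 \<Longrightarrow> nbrs (Gd 3) (V2 i) = insert (V1 i) (V2 ` ({..<3} - {i}))"
  "i < 2 \<Longrightarrow> nbrs (Gd 3) (V4 i) = V1 ` {..<3}"
proof -
  show "nbrs (Gd 3) (V1 i) = {V2 i, V4 0, V4 1}" if "i < 3"
  proof (rule set_eqI)
    fix x show "x \<in> nbrs (Gd 3) (V1 i) \<longleftrightarrow> x \<in> {V2 i, V4 0, V4 1}"
      using that by (cases x) auto
  qed
  show "nbrs (Gd 3) (V2 i) = insert (V1 i) (V2 ` ({..<3} - {i}))" if "i < 3"
  proof (rule set_eqI)
    fix x show "x \<in> nbrs (Gd 3) (V2 i) \<longleftrightarrow> x \<in> insert (V1 i) (V2 ` ({..<3} - {i}))"
      using that by (cases x) auto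
  qed
  show "nbrs (Gd 3) (V4 i) = V1 ` {..<3}" if "i < 2"
  proof (rule set_eqI)
    fix x show "x \<in> nbrs (Gd 3) (V4 i) \<longleftrightarrow> x \<in> V1 ` {..<3}"
      using that by (cases x) auto
  qed
qed

lemma cubic_Gd_3: "cubic (Gd 3)"
proof -
  interpret pair_graph "Gd 3" by (rule pair_graph_Gd_3)
  have root: "(u, V2 0) \<in> rtrancl_on (pverts (Gd 3)) (parcs (Gd 3))" if "u \<in> pverts (Gd 3)" for u
  proof -
    let ?R = "rtrancl_on (pverts (Gd 3)) (parcs (Gd 3))"
    have V2: "(V2 i, V2 0) \<in> ?R" if "i < 3" for i
      using that
      by (cases "i = 0") (auto intro: converse_rtrancl_on_into_rtrancl_on[of _ "V2 0"])
    have V1: "(V1 i, V2 0) \<in> ?R" if "i < 3" for i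
      using that by (intro converse_rtrancl_on_into_rtrancl_on[OF _ V2]) auto
    have V4: "(V4 i, V2 0) \<in> ?R" if "i < 2" for i
      using that by (intro converse_rtrancl_on_into_rtrancl_on[OF _ V1[of 0]]) auto
    show ?thesis
      using that V1 V2 V4 by (cases u) auto
  qed
  have sym: "sym (parcs (Gd 3))"
    using arcs_symmetric by (auto simp: sym_def)
  have "(u, v) \<in> rtrancl_on (pverts (Gd 3)) (parcs (Gd 3))"
    if "u \<in> pverts (Gd 3)" "v \<in> pverts (Gd 3)" for u v
    using root[OF that(1)] symD[OF rtrancl_on_sym[OF sym] root[OF that(2)]]
    by (rule rtrancl_on_trans)
  moreover have "(parcs (Gd 3))\<^sup>s = parcs (Gd 3)"
    using sym by (auto simp: symcl_def sym_def)
  moreover have "pverts (Gd 3) \<noteq> {}"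
    using Gd_3_verts(1)[of 0] by (auto simp del: Gd_3_verts)
  ultimately have "connected (with_proj (Gd 3))"
    by (simp add: connected_conv)
  moreover have "card (nbrs (Gd 3) v) = 3" if "v \<in> pverts (Gd 3)" for v
    using that
    by (cases v) (simp_all add: nbrs_Gd_3 card_image inj_on_def card_insert_if image_iff)
  ultimately show ?thesis
    using pair_graph_Gd_3
    by (simp add: cubic_def connected_graph_def out_degree_eq_card_nbrs)
qed

lemma not_complete_Gd_3: "\<not> complete_graph (Gd 3)"
proof
  assume "complete_graph (Gd 3)"
  then have "(V1 0, V1 1) \<in> parcs (Gd 3)"
    unfolding complete_graph_def complete_digraph_pair_def by (elim conjE) (erule ssubst, simp)
  then show False by simp
qed

text \<open>
  An independent set meets the clique \<open>V\<^sub>2\<close> at most once, and it lies on one side of the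
  complete bipartite graph between \<open>V\<^sub>1\<close> and \<open>V\<^sub>4\<close>.
\<close>

lemma ip\<^sub>4_Gd_3: "ip\<^sub>4 (Gd 3) \<le> 4"
proof (rule ip\<^sub>4_le[OF finite_Gd_3])
  fix S assume S: "independent_set (Gd 3) S"
  then have arc: "(x, y) \<notin> parcs (Gd 3)" if "x \<in> S" "y \<in> S" for x y
    using that by (auto simp: independent_set_def)
  have verts: "x \<in> pverts (Gd 3)" if "x \<in> S" for x
    using S that by (auto simp: independent_set_def)
  obtain k where k: "\<And>i. V2 i \<in> S \<Longrightarrow> i = k"
  proof (cases "\<exists>k. V2 k \<in> S")
    case True
    then obtain k where k: "V2 k \<in> S" by blast
    have "i = k" if "V2 i \<in> S" for i
      using arc[OF that k] verts[OF that] verts[OF k] by auto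
    then show ?thesis by (rule that)
  qed auto
  show "card S \<le> 4"
  proof (cases "\<exists>i. V1 i \<in> S")
    case True
    then obtain i where i: "V1 i \<in> S" by blast
    have "V4 j \<notin> S" for j
      using arc[OF i, of "V4 j"] verts[OF i] verts[of "V4 j"] by auto
    then have "S \<subseteq> {V2 k, V1 0, V1 1, V1 2}"
      using k verts by (intro subsetI, case_tac x) (fastforce simp: less_3_iff)+
    then have "card S \<le> card {V2 k, V1 0, V1 1, V1 2}"
      by (intro card_mono) auto
    then show ?thesis by simp
  next
    case False
    then have "S \<subseteq> {V2 k, V4 0, V4 1}"
      using k verts by (intro subsetI, case_tac x) (fastforce simp: less_2_iff)+
    then have "card S \<le> card {V2 k, V4 0, V4 1}"
      by (intro card_mono) auto
    then show ?thesis by simp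
  qed
qed

text \<open>
  The witness consists of \<open>V\<^sub>1\<close> together with the copies of \<open>V\<^sub>1\<close> and \<open>V\<^sub>2\<close>. The only arcs
  inside it join a vertex of \<open>V\<^sub>1\<close> to the copy of its matching partner; two nonadjacent vertices
  have a common neighbour: the root, a vertex of \<open>V\<^sub>4\<close> or a vertex of \<open>V\<^sub>2\<close>.
\<close>

lemma abundant_Gd_3: "abundant (Gd 3)"
proof -
  let ?M = "mycielskian (Gd 3)"
  let ?K = "(Orig \<circ> V1) ` {..<3} \<union> (Copy \<circ> V1) ` {..<3} \<union> (Copy \<circ> V2) ` {..<3}"
  have "general_position_set ?M ?K"
  proof (rule general_position_setI_diameter_2)
    show "?K \<subseteq> pverts ?M" by auto
  next
    fix x y assume "x \<in> ?K" "y \<in> ?K" "x \<noteq> y"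
    have common: "\<exists>w \<in> pverts ?M. (x, w) \<in> parcs ?M \<and> (w, y) \<in> parcs ?M"
      if "w \<in> pverts ?M" "(x, w) \<in> parcs ?M" "(w, y) \<in> parcs ?M" for w
      using that by blast
    consider i j where "x = Orig (V1 i)" "y = Copy (V2 j)" "i < 3" "j < 3"
      | i j where "x = Copy (V2 i)" "y = Orig (V1 j)" "i < 3" "j < 3"
      | i j where "x \<in> {Orig (V1 i), Copy (V1 i)}" "y \<in> {Orig (V1 j), Copy (V1 j)}"
          "x = Orig (V1 i) \<or> y = Orig (V1 j)" "i < 3" "j < 3"
      | u v where "x = Copy u" "y = Copy v" "u \<in> pverts (Gd 3)" "v \<in> pverts (Gd 3)"
      using \<open>x \<in> ?K\<close> \<open>y \<in> ?K\<close> by fastforce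
    then show "(x, y) \<in> parcs ?M \<or> (\<exists>w \<in> pverts ?M. (x, w) \<in> parcs ?M \<and> (w, y) \<in> parcs ?M)"
    proof cases
      case (1 i j)
      then show ?thesis using common[of "Orig (V2 i)"] by auto
    next
      case (2 i j)
      then show ?thesis using common[of "Orig (V2 j)"] by auto
    next
      case (3 i j)
      then show ?thesis using common[of "Orig (V4 0)"] by auto
    next
      case (4 u v)
      then show ?thesis using common[of Root] by auto
    qed
  next
    fix x y z assume "x \<in> ?K" "y \<in> ?K" "z \<in> ?K" "(x, y) \<in> parcs ?M" "(y, z) \<in> parcs ?M"
    then show "x = z" by auto
  qed
  then have "card ?K \<le> gp ?M"
    by (intro card_le_gp finite_pverts_mycielskian finite_Gd_3)
  moreover have "card ?K = 9"
    by (subst card_Un_disjoint, auto)+ (simp add: card_image inj_on_def)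
  ultimately show ?thesis
    using ip\<^sub>4_Gd_3 not_complete_Gd_3 by (simp add: abundant_def card_Gd_3)
qed

section \<open>General position sets of a Mycielskian\<close>

context
  fixes G :: "'a pair_pre_digraph" and K :: "'a mycielski_vertex set"
  assumes graph: "pair_graph G"
    and gp_set: "general_position_set (mycielskian G) K"
begin

interpretation pair_graph G by (rule graph)

interpretation M: pair_loopfree_digraph "mycielskian G"
  by (rule pair_loopfree_digraph_mycielskian)

lemma not_on_shortest_path_of_length_2:
  assumes "(x, y) \<in> parcs (mycielskian G)" "(y, z) \<in> parcs (mycielskian G)"
    "x \<noteq> z" "(x, z) \<notin> parcs (mycielskian G)" "x \<in> K" "y \<in> K" "z \<in> K"
  shows False
  using general_position_set_not_on_shortest_path[OF gp_set
      M.shortest_path_of_length_2[OF assms(1-4)], of x y z]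
    M.no_loops'[OF assms(1)] M.no_loops'[OF assms(2)] assms(3,5-7)
  by simp

text \<open>
  The constraints on \<open>K\<close> up to the end of this section each come from one path of length 2 or 3
  with three vertices in \<open>K\<close>. Such paths are shortest because copies are pairwise nonadjacent,
  no vertex is adjacent to its own copy, and the root is adjacent to copies only.
\<close>

lemma at_most_one_copy_if_Root:
  assumes "Root \<in> K" "Copy u \<in> K" "Copy v \<in> K" "u \<in> pverts G" "v \<in> pverts G"
  shows "u = v"
  using not_on_shortest_path_of_length_2[of "Copy u" Root "Copy v"] assms by auto

lemma nbr_of_copy_if_Root:
  assumes "Root \<in> K" "Copy t \<in> K" "(t, w) \<in> parcs G"
  shows "Orig w \<notin> K"
  using not_on_shortest_path_of_length_2[of Root "Copy t" "Orig w"] assms in_arcsD1 by auto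

lemma nbr_of_doubled:
  assumes "Orig a \<in> K" "Copy a \<in> K" "(a, w) \<in> parcs G"
  shows "Orig w \<notin> K"
  using not_on_shortest_path_of_length_2[of "Orig a" "Orig w" "Copy a"] assms
    arcs_symmetric no_loops' by auto

lemma at_most_one_copy_of_nbr:
  assumes "Orig w \<in> K" "Copy u \<in> K" "Copy v \<in> K" "(w, u) \<in> parcs G" "(w, v) \<in> parcs G"
  shows "u = v"
  using not_on_shortest_path_of_length_2[of "Copy u" "Orig w" "Copy v"] assms
    arcs_symmetric by auto

lemma nbrs_of_copy_adjacent:
  assumes "Copy w \<in> K" "Orig u \<in> K" "Orig v \<in> K" "(w, u) \<in> parcs G" "(w, v) \<in> parcs G" "u \<noteq> v"
  shows "(u, v) \<in> parcs G"
  using not_on_shortest_path_of_length_2[of "Orig u" "Copy w" "Orig v"] assms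
    arcs_symmetric by auto

text \<open>
  Otherwise \<open>Orig a, Copy c, Root, Copy t\<close> is a shortest path, however far apart \<open>a\<close> and \<open>t\<close> are
  in \<open>G\<close>.
\<close>

lemma common_nbr_with_copy:
  assumes "Orig a \<in> K" "Copy c \<in> K" "Copy t \<in> K" "(a, c) \<in> parcs G" "(a, t) \<notin> parcs G"
    "t \<in> pverts G"
  shows "\<exists>w. (a, w) \<in> parcs G \<and> (w, t) \<in> parcs G"
proof (rule ccontr)
  assume no: "\<nexists>w. (a, w) \<in> parcs G \<and> (w, t) \<in> parcs G"
  have "(v, Copy t) \<notin> parcs (mycielskian G)" if "(Orig a, v) \<in> parcs (mycielskian G)" for v
    using that no by (cases v) auto
  then have "shortest_path (mycielskian G) [Orig a, Copy c, Root, Copy t]"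
    using assms in_arcsD2[OF assms(4)] by (intro M.shortest_path_of_length_3) auto
  then show False
    using general_position_set_not_on_shortest_path[OF gp_set, of _ "Orig a" "Copy c" "Copy t"]
      assms by fastforce
qed

text \<open>
  Otherwise \<open>Orig b, Orig w, Orig a, Copy c\<close> is a shortest path.
\<close>

lemma shortcut_to_copy_of_nbr:
  assumes "Orig b \<in> K" "Orig a \<in> K" "Copy c \<in> K"
    and "(b, w) \<in> parcs G" "(w, a) \<in> parcs G" "(a, c) \<in> parcs G" "a \<noteq> b" "(b, c) \<notin> parcs G"
  shows "\<exists>x. (b, x) \<in> parcs G \<and> (x, c) \<in> parcs G"
proof (rule ccontr)
  assume no: "\<nexists>x. (b, x) \<in> parcs G \<and> (x, c) \<in> parcs G"
  have "(v, Copy c) \<notin> parcs (mycielskian G)" if "(Orig b, v) \<in> parcs (mycielskian G)" for v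
    using that no by (cases v) auto
  then have "shortest_path (mycielskian G) [Orig b, Orig w, Orig a, Copy c]"
    using assms by (intro M.shortest_path_of_length_3) auto
  then show False
    using general_position_set_not_on_shortest_path[OF gp_set, of _ "Orig b" "Orig a" "Copy c"]
      assms by fastforce
qed

end

section \<open>Large general position sets of cubic graphs\<close>

text \<open>
  If the root is selected, at most one copy is. Selecting the copy of \<open>t\<close> excludes the three
  neighbours of \<open>t\<close>, which is too expensive, and selecting no copy forces all of \<open>V\<close> to be
  selected, so that \<open>G\<close> has no induced path on three vertices and is complete.
\<close>

lemma Root_notin_large_general_position_set:
  assumes "cubic G" "\<not> complete_graph G"
    and K: "general_position_set (mycielskian G) K" "card (pverts G) < card K"
  shows "Root \<notin> K"
proof
  assume Root: "Root \<in> K"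
  interpret pair_graph G using assms(1) by (rule cubicD)
  define S where "S = {s. Orig s \<in> K}"
  define T where "T = {t. Copy t \<in> K}"
  have "K \<subseteq> pverts (mycielskian G)"
    using K(1) by (simp add: general_position_set_def)
  then have ST: "S \<subseteq> pverts G" "T \<subseteq> pverts G"
    by (auto simp: S_def T_def)
  have "K = Orig ` S \<union> Copy ` T \<union> {Root}"
  proof (rule set_eqI)
    fix x show "x \<in> K \<longleftrightarrow> x \<in> Orig ` S \<union> Copy ` T \<union> {Root}"
      using Root by (cases x) (auto simp: S_def T_def)
  qed
  then have "card K \<le> card (Orig ` S \<union> Copy ` T) + 1"
    using card_Un_le[of "Orig ` S \<union> Copy ` T" "{Root}"] by simp
  also have "\<dots> \<le> card (Orig ` S) + card (Copy ` T) + 1"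
    using card_Un_le by auto
  also have "\<dots> = card S + card T + 1"
    by (simp add: card_image inj_on_def)
  finally have large: "card (pverts G) \<le> card S + card T"
    using K(2) by simp
  show False
  proof (cases "T = {}")
    case True
    then have "S = pverts G"
      using large card_seteq[OF pair_finite_verts ST(1)] by simp
    then have "(x, z) \<in> parcs G" if "(x, y) \<in> parcs G" "(y, z) \<in> parcs G" "x \<noteq> z" for x y z
      using not_on_shortest_path_of_length_2[OF pair_graph K(1), of "Orig x" "Orig y" "Orig z"]
        that in_arcsD1[OF that(1)] in_arcsD2[OF that(1)] in_arcsD2[OF that(2)]
      by (auto simp: S_def set_eq_iff)
    then show False
      using complete_graph_if_no_induced_path cubicD(2) assms(1,2) by blast
  next
    case False
    then obtain t where t: "t \<in> T" by blast
    then have "T \<subseteq> {t}"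
      using at_most_one_copy_if_Root[OF pair_graph K(1) Root] ST(2) by (auto simp: T_def)
    then have "card T \<le> 1"
      using card_mono[of "{t}" T] by simp
    have "S \<inter> nbrs G t = {}"
      using nbr_of_copy_if_Root[OF pair_graph K(1) Root] t by (auto simp: S_def T_def)
    moreover have "nbrs G t \<subseteq> pverts G"
      using in_arcsD2 by auto
    then have "finite (nbrs G t)"
      using pair_finite_verts by (rule finite_subset)
    ultimately have "card S + card (nbrs G t) = card (S \<union> nbrs G t)"
      using finite_subset[OF ST(1) pair_finite_verts] by (simp add: card_Un_disjoint)
    also have "\<dots> \<le> card (pverts G)"
      using ST(1) in_arcsD2 by (intro card_mono pair_finite_verts) auto
    finally have "card S + card (nbrs G t) \<le> card (pverts G)" .
    then show False
      using large \<open>card T \<le> 1\<close> cubicD(3)[OF assms(1)] t ST(2) by auto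
  qed
qed

text \<open>
  Here \<open>S\<close> and \<open>T\<close> are the vertices selected themselves and through their copies, \<open>A\<close> those
  selected twice and \<open>D\<close> those not selected at all. As a cubic graph has three arcs out of each
  vertex, the inequality \<open>card D < card A\<close> becomes a surplus of at least three arcs that leave
  \<open>A\<close> without entering \<open>D\<close>. The constraints force these arcs into a matching \<open>P\<close> from \<open>A\<close> to
  \<open>T\<close>, and the other ends \<open>C\<close> of \<open>P\<close> into a clique. A vertex of \<open>C\<close> has only two neighbours left
  besides its partner, so \<open>C\<close> has exactly three vertices and every inequality is tight.
\<close>

lemma large_general_position_set_structure:
  assumes "cubic G"
    and K: "general_position_set (mycielskian G) K" "card (pverts G) < card K" "Root \<notin> K"
  obtains A D c where "pverts G = A \<union> c ` A \<union> D" "A \<inter> c ` A = {}" "A \<inter> D = {}" "c ` A \<inter> D = {}"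
    "card A = 3" "card D = 2" "inj_on c A" "\<And>a. a \<in> A \<Longrightarrow> (a, c a) \<in> parcs G"
    "\<And>a d. a \<in> A \<Longrightarrow> d \<in> D \<Longrightarrow> (a, d) \<in> parcs G"
    "\<And>a b. a \<in> A \<Longrightarrow> b \<in> A \<Longrightarrow> a \<noteq> b \<Longrightarrow> (c a, c b) \<in> parcs G"
proof -
  interpret pair_graph G using assms(1) by (rule cubicD)
  note deg = cubicD(3)[OF assms(1)]
  note gpG = pair_graph K(1)
  define S where "S = {s. Orig s \<in> K}"
  define T where "T = {t. Copy t \<in> K}"
  define A where "A = S \<inter> T"
  define D where "D = pverts G - (S \<union> T)"
  have "K \<subseteq> pverts (mycielskian G)"
    using K(1) by (simp add: general_position_set_def)
  then have ST: "S \<subseteq> pverts G" "T \<subseteq> pverts G"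
    by (auto simp: S_def T_def)
  have fin: "finite S" "finite T" "finite A" "finite D" and AD: "A \<subseteq> pverts G" "D \<subseteq> pverts G"
    using ST pair_finite_verts by (auto simp: A_def D_def intro: finite_subset)
  have fin_nbrs: "finite (nbrs G v)" for v
    using in_arcsD2 by (intro finite_subset[OF _ pair_finite_verts]) auto
  have "card D < card A"
  proof -
    have "K = Orig ` S \<union> Copy ` T"
    proof (rule set_eqI)
      fix x show "x \<in> K \<longleftrightarrow> x \<in> Orig ` S \<union> Copy ` T"
        using K(3) by (cases x) (auto simp: S_def T_def)
    qed
    moreover have "Orig ` S \<inter> Copy ` T = {}"
      by auto
    ultimately have "card K = card S + card T"
      using fin by (simp add: card_Un_disjoint card_image inj_on_def)
    moreover have "card S + card T = card (S \<union> T) + card A"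
      using card_Un_Int[OF fin(1,2)] by (simp add: A_def)
    moreover have "card (S \<union> T) + card D = card (pverts G)"
      using ST pair_finite_verts fin
      by (simp add: D_def card_Diff_subset card_mono)
    ultimately show ?thesis using K(2) by linarith
  qed

  have A_nbr: "y \<notin> S" if "a \<in> A" "(a, y) \<in> parcs G" for a y
    using nbr_of_doubled[OF gpG] that by (auto simp: A_def S_def T_def)
  (* P and F together are the arcs leaving A; F reversed and H together are the arcs leaving D.
     The arcs F between A and D cancel when the two counts are compared. *)
  define P where "P = {(a, t). a \<in> A \<and> t \<in> T \<and> (a, t) \<in> parcs G}"
  define F where "F = {(a, d). a \<in> A \<and> d \<in> D \<and> (a, d) \<in> parcs G}"
  define H where "H = {(d, x). d \<in> D \<and> x \<notin> A \<and> (d, x) \<in> parcs G}"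
  have P_fst: "t = t'" if "(a, t) \<in> P" "(a, t') \<in> P" for a t t'
    using at_most_one_copy_of_nbr[OF gpG, of a t t'] that by (auto simp: P_def A_def S_def T_def)
  have P_snd: "a = a'" if "(a, t) \<in> P" "(a', t) \<in> P" for a a' t
  proof (rule ccontr)
    assume "a \<noteq> a'"
    then have "(a, a') \<in> parcs G"
      using nbrs_of_copy_adjacent[OF gpG, of t a a'] that arcs_symmetric
      by (auto simp: P_def A_def S_def T_def)
    then show False
      using A_nbr[of a a'] that by (auto simp: P_def A_def)
  qed
  have inj: "inj_on fst P" "inj_on snd P"
    using P_fst P_snd by (auto simp: inj_on_def)
  have sub: "P \<subseteq> parcs G" "F \<subseteq> parcs G" "H \<subseteq> parcs G"
    by (auto simp: P_def F_def H_def)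
  then have finP: "finite P" "finite F" "finite H"
    using pair_finite_arcs by (auto intro: finite_subset)
  have cardP: "card P + 3 * card D = 3 * card A + card H"
  proof -
    have "Sigma A (nbrs G) = P \<union> F"
      using A_nbr in_arcsD2 by (auto simp: P_def F_def D_def)
    moreover have "P \<inter> F = {}"
      by (auto simp: P_def F_def D_def)
    ultimately have "card P + card F = card (Sigma A (nbrs G))"
      using finP by (simp add: card_Un_disjoint)
    also have "\<dots> = (\<Sum>a\<in>A. card (nbrs G a))"
      using fin fin_nbrs by (intro card_SigmaI) auto
    also have "\<dots> = 3 * card A"
      using deg AD by (simp add: subset_iff)
    finally have 1: "card P + card F = 3 * card A" .
    have "Sigma D (nbrs G) = F\<inverse> \<union> H"
      using arcs_symmetric by (auto simp: F_def H_def)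
    moreover have "F\<inverse> \<inter> H = {}"
      by (auto simp: F_def H_def)
    ultimately have "card (F\<inverse>) + card H = card (Sigma D (nbrs G))"
      using finP by (simp add: card_Un_disjoint)
    also have "\<dots> = (\<Sum>a\<in>D. card (nbrs G a))"
      using fin fin_nbrs by (intro card_SigmaI) auto
    also have "\<dots> = 3 * card D"
      using deg AD by (simp add: subset_iff)
    finally have 2: "card F + card H = 3 * card D"
      by simp
    from 1 2 show ?thesis by linarith
  qed

  (* At most card H elements of C have a neighbour in D, so the set C0 of the others still has
     at least three elements. *)
  define C where "C = snd ` P"
  define C0 where "C0 = {c \<in> C. \<forall>d \<in> D. (c, d) \<notin> parcs G}"
  have CT: "C \<subseteq> T" and CS: "C \<inter> S = {}"
    using A_nbr by (auto simp: C_def P_def)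
  have finC: "finite C" and cardC: "card C = card P"
    using finP inj by (auto simp: C_def card_image)
  (* The partner a' of c' has a common neighbour with c. All neighbours of a' other than c' lie
     in D, which c avoids, so the common neighbour is c' itself. *)
  have adj: "(c, c') \<in> parcs G" if cc: "c \<in> C0" "c' \<in> C" "c \<noteq> c'" for c c'
  proof -
    obtain a' where a': "(a', c') \<in> P"
      using cc(2) by (auto simp: C_def)
    have "(a', c) \<notin> parcs G"
      using P_fst[OF a', of c] a' cc CT by (auto simp: P_def C0_def)
    then obtain w where w: "(a', w) \<in> parcs G" "(w, c) \<in> parcs G"
      using common_nbr_with_copy[OF gpG, of a' c' c] a' cc CT ST(2)
      by (auto simp: P_def A_def S_def T_def C0_def)
    have "w \<notin> S"
      using A_nbr w a' by (auto simp: P_def)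
    moreover have "w \<notin> D"
      using w cc(1) arcs_symmetric by (auto simp: C0_def)
    ultimately have "(a', w) \<in> P"
      using w in_arcsD2 a' by (auto simp: P_def D_def)
    then have "w = c'"
      using P_fst a' by blast
    then show ?thesis
      using w arcs_symmetric by blast
  qed
  have "card C \<le> card C0 + card H"
  proof -
    have "C - C0 \<subseteq> snd ` H"
    proof
      fix c assume c: "c \<in> C - C0"
      then obtain d where "d \<in> D" "(c, d) \<in> parcs G"
        by (auto simp: C0_def)
      then have "(d, c) \<in> H"
        using c CS arcs_symmetric by (auto simp: H_def A_def)
      then show "c \<in> snd ` H" by force
    qed
    then have "card (C - C0) \<le> card H"
      using finP(3) by (meson card_image_le card_mono finite_imageI le_trans)
    moreover have "card C \<le> card C0 + card (C - C0)"
      using card_Un_le[of C0 "C - C0"] by (simp add: C0_def Un_absorb1 subset_iff)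
    ultimately show ?thesis by linarith
  qed
  with cardP cardC \<open>card D < card A\<close> have "3 \<le> card C0"
    by linarith
  have nbrs_C0: "nbrs G c = insert a (C - {c}) \<and> card C = 3" if "c \<in> C0" "(a, c) \<in> P" for a c
  proof -
    have "a \<notin> C"
      using CS that by (auto simp: P_def A_def)
    have "c \<in> C"
      using that(1) by (simp add: C0_def)
    then have nc: "card (nbrs G c) = 3"
      using CT ST(2) by (intro deg) blast
    have sub: "insert a (C - {c}) \<subseteq> nbrs G c"
      using adj that arcs_symmetric by (auto simp: P_def)
    have "card (insert a (C - {c})) = card C"
      using \<open>a \<notin> C\<close> \<open>c \<in> C\<close> finC card_Suc_Diff1[of C c] by simp
    moreover have "card (insert a (C - {c})) \<le> 3"
      using card_mono[OF fin_nbrs sub] nc by simp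
    moreover have "card C0 \<le> card C"
      using finC by (intro card_mono) (auto simp: C0_def)
    ultimately have "card C = 3" "card (insert a (C - {c})) = card (nbrs G c)"
      using \<open>3 \<le> card C0\<close> nc by linarith+
    then show ?thesis
      using card_subset_eq[OF fin_nbrs sub] by simp
  qed
  have "C0 \<noteq> {}"
    using \<open>3 \<le> card C0\<close> by auto
  then have C3: "card C = 3"
    using nbrs_C0 by (fastforce simp: C0_def C_def)
  then have "C0 = C"
    using \<open>3 \<le> card C0\<close> finC by (intro card_seteq) (auto simp: C0_def)
  have "card H = 0" "card A = Suc (card D)"
    using cardP C3 cardC \<open>card D < card A\<close> by linarith+
  then have "H = {}"
    using finP by simp

  (* An unmatched b in A shares a neighbour w with a matched a, where w lies in D; the path
     Orig b, Orig w, Orig a, Copy c is then shortest, because the neighbours of c are a and the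
     rest of C, none of which is adjacent to b. *)
  have A_eq: "A = fst ` P"
  proof (rule ccontr)
    assume "A \<noteq> fst ` P"
    then obtain b where b: "b \<in> A" "b \<notin> fst ` P"
      by (auto simp: P_def)
    have "P \<noteq> {}"
      using C3 cardC by auto
    then obtain a c where ac: "(a, c) \<in> P" by auto
    then have "c \<in> C0"
      using \<open>C0 = C\<close> by (force simp: C_def)
    have "a \<noteq> b"
      using b ac by force
    have in_P: "(b, t) \<notin> parcs G" if "t \<in> T" for t
      using b that by (force simp: P_def)
    have "(a, b) \<notin> parcs G"
      using A_nbr ac b by (auto simp: P_def A_def)
    then obtain w where w: "(a, w) \<in> parcs G" "(w, b) \<in> parcs G"
      using common_nbr_with_copy[OF gpG, of a c b] ac b ST(2)
      by (auto simp: P_def A_def S_def T_def)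
    then obtain x where x: "(b, x) \<in> parcs G" "(x, c) \<in> parcs G"
      using shortcut_to_copy_of_nbr[OF gpG, of b a c w] in_P[of c] ac b \<open>a \<noteq> b\<close> arcs_symmetric
      by (auto simp: P_def A_def S_def T_def)
    then have "x \<in> insert a (C - {c})"
      using nbrs_C0[OF \<open>c \<in> C0\<close> ac] arcs_symmetric by blast
    then have "x \<in> T"
      using CT ac by (auto simp: P_def A_def)
    then show False
      using in_P x by blast
  qed
  then have A3: "card A = 3"
    using C3 cardC inj(1) by (simp add: card_image)
  then have D2: "card D = 2"
    using \<open>card A = Suc (card D)\<close> by simp
  have nbrs_D: "nbrs G d = A" if "d \<in> D" for d
  proof (rule card_subset_eq[OF fin(3)])
    show "nbrs G d \<subseteq> A"
      using that \<open>H = {}\<close> by (auto simp: H_def)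
    show "card (nbrs G d) = card A"
      using deg that AD A3 by auto
  qed

  define c where "c = (\<lambda>a. THE t. (a, t) \<in> P)"
  have c: "(a, c a) \<in> P" if "a \<in> A" for a
    unfolding c_def
  proof (rule theI')
    show "\<exists>!t. (a, t) \<in> P"
      using that P_fst unfolding A_eq by fastforce
  qed
  have C_eq: "C = c ` A"
  proof
    show "C \<subseteq> c ` A"
    proof
      fix t assume "t \<in> C"
      then obtain a where a: "(a, t) \<in> P" by (auto simp: C_def)
      then have "a \<in> A" by (simp add: P_def)
      then have "t = c a" using c P_fst a by blast
      then show "t \<in> c ` A" using \<open>a \<in> A\<close> by blast
    qed
    show "c ` A \<subseteq> C"
      using c by (force simp: C_def)
  qed
  have inj_c: "inj_on c A"
    using c P_snd by (metis inj_onI)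
  have AC: "(a, c a) \<in> parcs G" if "a \<in> A" for a
    using c[OF that] by (simp add: P_def)
  have AD': "(a, d) \<in> parcs G" if "a \<in> A" "d \<in> D" for a d
    using nbrs_D[OF that(2)] that(1) arcs_symmetric by blast
  have CC: "(c a, c b) \<in> parcs G" if "a \<in> A" "b \<in> A" "a \<noteq> b" for a b
    using adj[of "c a" "c b"] that inj_c \<open>C0 = C\<close> C_eq by (auto simp: inj_on_def)
  have disj: "A \<inter> C = {}" "A \<inter> D = {}" "C \<inter> D = {}"
    using CS CT by (auto simp: A_def D_def)
  (* The arcs found so far use up all three neighbours of each of these eight vertices. *)
  have "A \<union> C \<union> D = pverts G"
  proof (rule connected_graph_closed_set[OF cubicD(2)[OF assms(1)]])
    show "A \<union> C \<union> D \<subseteq> pverts G" "A \<union> C \<union> D \<noteq> {}"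
      using AD CT ST A3 by auto
    fix x assume "x \<in> A \<union> C \<union> D"
    then consider "x \<in> A" | "x \<in> C" | "x \<in> D" by blast
    then show "nbrs G x \<subseteq> A \<union> C \<union> D"
    proof cases
      case 1
      then show ?thesis
        using A_nbr in_arcsD2 by (force simp: D_def C_def P_def)
    next
      case 2
      then obtain a where "(a, x) \<in> P" by (auto simp: C_def)
      then show ?thesis
        using nbrs_C0[of x a] 2 \<open>C0 = C\<close> by (auto simp: P_def)
    next
      case 3
      then show ?thesis using nbrs_D by auto
    qed
  qed
  then show ?thesis
    using that[of A c D] disj inj_c A3 D2 AC AD' CC unfolding C_eq by metis
qed

section \<open>Recognising G(3)\<close>

text \<open>
  Cubic graphs on equally many vertices have equally many arcs, so a bijection that preserves arcs
  already reaches all of them. The isomorphism required runs from \<open>G\<close> to \<open>H\<close>, hence the inverse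
  of \<open>f\<close>.
\<close>

lemma bijective_hom_of_cubic_imp_iso:
  assumes "cubic G" "cubic H" "bij_betw f (pverts H) (pverts G)"
    and hom: "\<And>x y. (x, y) \<in> parcs H \<Longrightarrow> (f x, f y) \<in> parcs G"
  shows "digraph_iso (with_proj G) (with_proj H)"
proof -
  interpret G: pair_graph G using assms(1) by (rule cubicD)
  interpret H: pair_graph H using assms(2) by (rule cubicD)
  have card_arcs: "card (parcs L) = 3 * card (pverts L)" if "cubic L" for L :: "'c pair_pre_digraph"
  proof -
    interpret L: pair_graph L using that by (rule cubicD)
    have "parcs L = Sigma (pverts L) (nbrs L)"
      using L.in_arcsD1 by auto
    moreover have "finite (nbrs L v)" for v
      using L.in_arcsD2 by (intro finite_subset[OF _ L.pair_finite_verts]) auto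
    then have "card (Sigma (pverts L) (nbrs L)) = (\<Sum>v\<in>pverts L. card (nbrs L v))"
      using L.pair_finite_verts by (intro card_SigmaI) auto
    ultimately show ?thesis
      using cubicD(3)[OF that] by simp
  qed
  have inj: "inj_on f (pverts H)" and img: "f ` pverts H = pverts G"
    using assms(3) by (auto simp: bij_betw_def)
  have inj_arcs: "inj_on (map_prod f f) (parcs H)"
    using H.in_arcsD1 H.in_arcsD2
    by (intro inj_on_subset[OF map_prod_inj_on[OF inj inj]]) auto
  have "map_prod f f ` parcs H = parcs G"
  proof (rule card_subset_eq[OF G.pair_finite_arcs])
    show "map_prod f f ` parcs H \<subseteq> parcs G"
      using hom by auto
    show "card (map_prod f f ` parcs H) = card (parcs G)"
      using card_arcs assms(1-3) bij_betw_same_card[OF assms(3)]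
      by (simp add: card_image[OF inj_arcs] card_arcs)
  qed
  define g where "g = the_inv_into (pverts H) f"
  have gf: "g (f x) = x" if "x \<in> pverts H" for x
    using that inj by (simp add: g_def the_inv_into_f_f)
  have g_img: "g ` pverts G = pverts H"
    unfolding img[symmetric] using gf by (force simp: image_image)
  have "map_prod g g (map_prod f f e) = e" if "e \<in> parcs H" for e
    using that gf H.in_arcsD1 H.in_arcsD2 by (cases e) auto
  then have g_arcs: "map_prod g g ` parcs G = parcs H"
    unfolding \<open>map_prod f f ` parcs H = parcs G\<close>[symmetric] image_image by simp
  have g_inj: "inj_on g (pverts G)"
    using inj_on_the_inv_into[OF inj] by (simp add: g_def img)
  have g_arcs_inj: "inj_on (map_prod g g) (parcs G)"
    using G.in_arcsD1 G.in_arcsD2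
    by (intro inj_on_subset[OF map_prod_inj_on[OF g_inj g_inj]]) auto
  let ?hom = "\<lparr>iso_verts = g, iso_arcs = map_prod g g, iso_head = snd, iso_tail = fst\<rparr>"
  have "pre_digraph.digraph_isomorphism (with_proj G) ?hom"
    unfolding pre_digraph.digraph_isomorphism_def
    using g_inj g_arcs_inj G.wf_digraph_axioms by auto
  moreover have "with_proj H = app_iso ?hom (with_proj G)"
    by (simp add: app_iso_def with_proj_def g_img g_arcs)
  ultimately show ?thesis
    by (auto simp: digraph_iso_def)
qed

lemma iso_Gd_3I:
  assumes "cubic G"
    and verts: "pverts G = A \<union> c ` A \<union> D"
    and disj: "A \<inter> c ` A = {}" "A \<inter> D = {}" "c ` A \<inter> D = {}"
    and card: "card A = 3" "card D = 2" and inj: "inj_on c A"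
    and AC: "\<And>a. a \<in> A \<Longrightarrow> (a, c a) \<in> parcs G"
    and AD: "\<And>a d. a \<in> A \<Longrightarrow> d \<in> D \<Longrightarrow> (a, d) \<in> parcs G"
    and CC: "\<And>a b. a \<in> A \<Longrightarrow> b \<in> A \<Longrightarrow> a \<noteq> b \<Longrightarrow> (c a, c b) \<in> parcs G"
  shows "digraph_iso (with_proj G) (with_proj (Gd 3))"
proof -
  interpret pair_graph G using assms(1) by (rule cubicD)
  have "finite A" "finite D"
    using card by (auto intro: card_ge_0_finite)
  then obtain a d where a: "bij_betw a {0..<3::nat} A" and d: "bij_betw d {0..<2::nat} D"
    using ex_bij_betw_nat_finite card by metis
  have a_inj: "a i = a j \<longleftrightarrow> i = j" if "i < 3" "j < 3" for i j
    using that a by (auto simp: bij_betw_def inj_on_def)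
  have d_inj: "d i = d j \<longleftrightarrow> i = j" if "i < 2" "j < 2" for i j
    using that d by (auto simp: bij_betw_def inj_on_def)
  have aA: "a i \<in> A" if "i < 3" for i
    using that bij_betwE[OF a] by auto
  have dD: "d i \<in> D" if "i < 2" for i
    using that bij_betwE[OF d] by auto
  have c_inj: "c x = c y \<longleftrightarrow> x = y" if "x \<in> A" "y \<in> A" for x y
    using that inj by (auto simp: inj_on_def)
  define f where "f x = (case x of V1 i \<Rightarrow> a i | V2 i \<Rightarrow> c (a i) | V4 i \<Rightarrow> d i)" for x
  have f [simp]: "f (V1 i) = a i" "f (V2 i) = c (a i)" "f (V4 i) = d i" for i
    by (simp_all add: f_def)
  show ?thesis
  proof (rule bijective_hom_of_cubic_imp_iso[OF assms(1) cubic_Gd_3])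
    have "inj_on f (pverts (Gd 3))"
    proof (rule inj_onI)
      fix x y assume "x \<in> pverts (Gd 3)" "y \<in> pverts (Gd 3)" "f x = f y"
      moreover have "a i \<noteq> c (a j)" "c (a j) \<noteq> a i" if "i < 3" "j < 3" for i j
        using aA[OF that(1)] aA[OF that(2)] disj(1) by force+
      moreover have "a i \<noteq> d j" "d j \<noteq> a i" "c (a i) \<noteq> d j" "d j \<noteq> c (a i)"
        if "i < 3" "j < 2" for i j
        using aA[OF that(1)] dD[OF that(2)] disj(2,3) by force+
      ultimately show "x = y"
        by (cases x; cases y) (simp_all add: a_inj d_inj c_inj aA)
    qed
    moreover have "f ` pverts (Gd 3) = pverts G"
    proof -
      have "f ` pverts (Gd 3) = a ` {0..<3} \<union> c ` a ` {0..<3} \<union> d ` {0..<2}"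
        by (simp add: Gd_def image_Un image_image lessThan_atLeast0)
      then show ?thesis
        using a d verts by (simp add: bij_betw_def)
    qed
    ultimately show "bij_betw f (pverts (Gd 3)) (pverts G)"
      by (simp add: bij_betw_def)
  next
    fix x y assume "(x, y) \<in> parcs (Gd 3)"
    then show "(f x, f y) \<in> parcs G"
      by (cases x; cases y)
        (auto simp: a_inj aA dD intro: AC AD CC arcs_symmetric[OF AC] arcs_symmetric[OF AD])
  qed
qed

theorem theorem24:
  "(cubic (Gd 3) \<and> \<not> complete_graph (Gd 3) \<and> abundant (Gd 3)) \<and>
   (\<forall>G :: 'a pair_pre_digraph.
      cubic G \<and> \<not> complete_graph G \<and> abundant G \<longrightarrow>
      digraph_iso (with_proj G) (with_proj (Gd 3)))"
proof (intro conjI allI impI)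
  show "cubic (Gd 3)" "\<not> complete_graph (Gd 3)" "abundant (Gd 3)"
    by (rule cubic_Gd_3 not_complete_Gd_3 abundant_Gd_3)+
next
  fix G :: "'a pair_pre_digraph"
  assume "cubic G \<and> \<not> complete_graph G \<and> abundant G"
  then have G: "cubic G" "\<not> complete_graph G" and "card (pverts G) < gp (mycielskian G)"
    by (auto simp: abundant_def)
  interpret pair_graph G using G(1) by (rule cubicD)
  obtain K where K: "general_position_set (mycielskian G) K" "card (pverts G) < card K"
    using gp_greaterE[OF finite_pverts_mycielskian[OF pair_finite_verts]]
      \<open>card (pverts G) < gp (mycielskian G)\<close> .
  show "digraph_iso (with_proj G) (with_proj (Gd 3))"
    using large_general_position_set_structure[OF G(1) K
        Root_notin_large_general_position_set[OF G K]] iso_Gd_3I[OF G(1)]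
    by metis
qed

end
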